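(* Let $f:[a,b]\to\mathbb R$ be a continuous function. Then there exist $c\in\,]a,b[$ and $\alpha,\beta\in\mathbb R^+$ such that $$D_{\alpha,\beta}[f](c)=\frac{f(b)-f(a)}{b-a}.$$
   Context: For $f:[a,b]\to\mathbb R$ and $\alpha,\beta>0$ with $b-a>\max\{\alpha,\beta\}$, the $\alpha,\beta$-symmetric difference derivative is $D_{\alpha,\beta}[f](t)=\frac{f(t+\alpha)-f(t-\beta)}{\alpha+\beta}$, defined for $t\in[a,b]\setminus([a,a+\beta]\cup[b-\alpha,b])$. The displayed equation includes the assertion that $c$ lies in this domain. $\mathbb R^+$ denotes the positive reals and $a<b$. *)

theory Defs
  imports Complex_Main
begin

text \<open>
  The \<open>\<alpha>,\<beta>\<close>-symmetric difference derivative of a function on \<open>[a,b]\<close>. HOL functions are total,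
  so the formula and the set of points at which it is defined are given separately; for \<open>\<alpha>, \<beta> > 0\<close>, on
  \<open>sym_diff_domain a b \<alpha> \<beta>\<close> both \<open>t + \<alpha>\<close> and \<open>t - \<beta>\<close> lie in \<open>[a,b]\<close>, so that only
  values of \<open>f\<close> on \<open>[a,b]\<close> are used.
\<close>

definition sym_diff_deriv :: "real \<Rightarrow> real \<Rightarrow> (real \<Rightarrow> real) \<Rightarrow> real \<Rightarrow> real" where
  "sym_diff_deriv \<alpha> \<beta> f t = (f (t + \<alpha>) - f (t - \<beta>)) / (\<alpha> + \<beta>)"

definition sym_diff_domain :: "real \<Rightarrow> real \<Rightarrow> real \<Rightarrow> real \<Rightarrow> real set" where
  "sym_diff_domain a b \<alpha> \<beta> = {a..b} - ({a..a + \<beta>} \<union> {b - \<alpha>..b})"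

end

theory Submission
  imports Defs
begin

text \<open>
  Subtracting the chord of \<open>f\<close> gives a continuous \<open>g\<close> with \<open>g a = g b\<close>. Such a \<open>g\<close> takes some value
  at two distinct interior points \<open>u < v\<close>: either it is constant, or it differs from \<open>g a\<close> at some
  interior point \<open>m\<close> and then each value strictly between \<open>g a\<close> and \<open>g m\<close> is attained on both sides
  of \<open>m\<close>. The midpoint of \<open>u\<close> and \<open>v\<close> is the required \<open>c\<close>, with \<open>\<alpha> = \<beta> = (v - u) / 2\<close>.
\<close>

lemma interior_equal_values_of_greater:
  fixes g :: "real \<Rightarrow> real"
  assumes "a < m" "m < b" and cont: "continuous_on {a..b} g" and "g a = g b" "g a < g m"
  shows "\<exists>u v. a < u \<and> u < v \<and> v < b \<and> g u = g v"
proof -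
  define y where "y = (g a + g m) / 2"
  have y: "g a < y" "y < g m" "g b < y"
    using assms by (auto simp: y_def)
  have "continuous_on {a..m} g" "continuous_on {m..b} g"
    using assms by (auto intro: continuous_on_subset[OF cont])
  then obtain u v where u: "a \<le> u" "u \<le> m" "g u = y" and v: "m \<le> v" "v \<le> b" "g v = y"
    using IVT'[of g a y m] IVT2'[of g b y m] y assms(1,2) by (meson less_imp_le)
  have "u \<noteq> a" "u \<noteq> m" "v \<noteq> b"
    using y u v by auto
  with u v show ?thesis
    by (intro exI[of _ u] exI[of _ v]) auto
qed

text \<open>The pair \<open>a\<close>, \<open>b\<close> itself will not do:
  \<open>sym_diff_domain\<close> omits the points \<open>a + \<beta>\<close> and
  \<open>b - \<alpha>\<close>, which forces \<open>a < c - \<beta>\<close> and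
  \<open>c + \<alpha> < b\<close>.\<close>

lemma interior_equal_values:
  fixes g :: "real \<Rightarrow> real"
  assumes "a < b" and cont: "continuous_on {a..b} g" and eq: "g a = g b"
  shows "\<exists>u v. a < u \<and> u < v \<and> v < b \<and> g u = g v"
proof (cases "\<exists>m. a < m \<and> m < b \<and> g m \<noteq> g a")
  case True
  then obtain m where m: "a < m" "m < b" "g m \<noteq> g a" by blast
  show ?thesis
  proof (cases "g a < g m")
    case True
    then show ?thesis
      using interior_equal_values_of_greater[OF m(1,2) cont eq] by blast
  next
    case False
    \<comment> \<open>Now \<open>g m < g a\<close>; negation reverses this and preserves
      coincidences of values.\<close>
    have "continuous_on {a..b} (\<lambda>x. - g x)"
      using cont by (rule continuous_on_minus)
    from interior_equal_values_of_greater[OF m(1,2) this] show ?thesis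
      using False m(3) eq by auto
  qed
next
  case False
  obtain u where u: "a < u" "u < b" using dense[OF \<open>a < b\<close>] by blast
  obtain v where "u < v" "v < b" using dense[OF u(2)] by blast
  with u False show ?thesis by (metis less_trans)
qed

theorem theorem5p3p14:
  fixes f :: "real \<Rightarrow> real" and a b :: real
  assumes "a < b"
    and "continuous_on {a..b} f"
  shows "\<exists>c \<alpha> \<beta>. c \<in> {a<..<b} \<and> \<alpha> > 0 \<and> \<beta> > 0 \<and> b - a > max \<alpha> \<beta> \<and>
           c \<in> sym_diff_domain a b \<alpha> \<beta> \<and>
           sym_diff_deriv \<alpha> \<beta> f c = (f b - f a) / (b - a)"
proof -
  define s where "s = (f b - f a) / (b - a)"
  define g where "g x = f x - s * x" for x
  have "s * (b - a) = f b - f a"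
    using assms(1) by (simp add: s_def)
  then have "g a = g b"
    by (simp add: g_def algebra_simps)
  moreover have "continuous_on {a..b} g"
    unfolding g_def using assms(2) by (intro continuous_intros)
  ultimately obtain u v where uv: "a < u" "u < v" "v < b" "g u = g v"
    using interior_equal_values[OF assms(1)] by blast
  define c h where "c = (u + v) / 2" and "h = (v - u) / 2"
  have ch: "c + h = v" "c - h = u" "h + h = v - u"
    by (simp_all add: c_def h_def field_simps)
  \<comment> \<open>Equal values of \<open>g\<close> mean that the chord of \<open>f\<close> over
    \<open>[u, v]\<close> has slope \<open>s\<close>.\<close>
  have "f v - f u = s * (v - u)"
    using uv(4) by (simp add: g_def algebra_simps)
  then have "sym_diff_deriv h h f c = s"
    using uv(2) by (simp add: sym_diff_deriv_def ch)
  moreover have "c \<in> {a<..<b}" "h > 0" "b - a > max h h" "c \<in> sym_diff_domain a b h h"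
    using uv ch by (auto simp: sym_diff_domain_def)
  ultimately show ?thesis
    unfolding s_def by blast
qed

end
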